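(* Suppose that $G$ is an étale groupoid and that $G^{(0)}$ is a manifold of dimension $n$. For a smooth atlas $\{(W_\alpha,\psi_\alpha):\alpha\in\mathfrak{A}\}$ for $G^{(0)}$, let $$\mathfrak{R}:=\{(B,\alpha): B\text{ is an open bisection of }G\text{ and }\alpha\in\mathfrak{A}\text{ such that }r(B)\subseteq W_\alpha\},$$ and for each $\rho=(B,\alpha)\in\mathfrak{R}$ define $U_\rho=B$ and $\varphi_\rho:U_\rho\to\mathbb{R}^n$ by $\varphi_\rho(\gamma):=\psi_\alpha(r(\gamma))$. Then $\mathcal{R}:=\{(U_\rho,\varphi_\rho):\rho\in\mathfrak{R}\}$ is an atlas for a smooth structure on $G$. Moreover, any other smooth structure $\mathcal{B}$ on $G$ with respect to which $r:(G,\mathcal{B})\to G^{(0)}$ is a local diffeomorphism is compatible with $\mathcal{R}$.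
   Context: "Manifold" means smooth manifold: Hausdorff, second-countable, locally Euclidean, with a maximal smooth atlas; smooth structures on $G$ are compatible with the given topology on $G$. Two smooth atlases are compatible if their union is a smooth atlas. All groupoids are locally compact Hausdorff topological groupoids with unit space $G^{(0)}\subseteq G$ (subspace topology), continuous surjective range and source maps $r,s:G\to G^{(0)}$, and continuous composition and inversion. $G$ is étale if $r,s$ are local homeomorphisms; an open bisection is an open $U\subseteq G$ such that $r|_U,s|_U$ are homeomorphisms onto open subsets of $G^{(0)}$. *)

theory Defs
  imports "HOL-Analysis.Analysis"
begin

section \<open>Etale groupoids\<close>

text \<open>The topology \<open>X\<close> carries the set of arrows and \<open>G0\<close> is the unit space, a set of arrows with the
  subspace topology. The product \<open>mul a b\<close> is meaningful only on the composable pairs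
  \<open>{(a, b). s a = r b}\<close>. Surjectivity of \<open>r\<close> and \<open>s\<close> onto \<open>G0\<close> follows from \<open>r_unit\<close> and \<open>s_unit\<close>.\<close>

locale lch_groupoid =
  fixes X :: "'g topology" and G0 :: "'g set"
    and r s :: "'g \<Rightarrow> 'g" and mul :: "'g \<Rightarrow> 'g \<Rightarrow> 'g" and iv :: "'g \<Rightarrow> 'g"
  assumes units_subset: "G0 \<subseteq> topspace X"
    and r_unit: "u \<in> G0 \<Longrightarrow> r u = u"
    and s_unit: "u \<in> G0 \<Longrightarrow> s u = u"
    and r_mul: "\<lbrakk>a \<in> topspace X; b \<in> topspace X; s a = r b\<rbrakk> \<Longrightarrow> r (mul a b) = r a"
    and s_mul: "\<lbrakk>a \<in> topspace X; b \<in> topspace X; s a = r b\<rbrakk> \<Longrightarrow> s (mul a b) = s b"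
    and mul_assoc: "\<lbrakk>a \<in> topspace X; b \<in> topspace X; c \<in> topspace X; s a = r b; s b = r c\<rbrakk>
        \<Longrightarrow> mul (mul a b) c = mul a (mul b c)"
    and mul_left_unit: "a \<in> topspace X \<Longrightarrow> mul (r a) a = a"
    and mul_right_unit: "a \<in> topspace X \<Longrightarrow> mul a (s a) = a"
    and r_iv: "a \<in> topspace X \<Longrightarrow> r (iv a) = s a"
    and s_iv: "a \<in> topspace X \<Longrightarrow> s (iv a) = r a"
    and mul_right_iv: "a \<in> topspace X \<Longrightarrow> mul a (iv a) = r a"
    and mul_left_iv: "a \<in> topspace X \<Longrightarrow> mul (iv a) a = s a"
    and Hausdorff: "Hausdorff_space X"
    and locally_compact: "locally_compact_space X"
    and continuous_r: "continuous_map X (subtopology X G0) r"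
    and continuous_s: "continuous_map X (subtopology X G0) s"
    and continuous_mul: "continuous_map
        (subtopology (prod_topology X X) {(a, b). s a = r b}) X (\<lambda>(a, b). mul a b)"
    and continuous_iv: "continuous_map X X iv"

definition local_homeomorphism :: "'a topology \<Rightarrow> 'b topology \<Rightarrow> ('a \<Rightarrow> 'b) \<Rightarrow> bool" where
  "local_homeomorphism X Y f \<longleftrightarrow>
    (\<forall>x\<in>topspace X. \<exists>U. openin X U \<and> x \<in> U \<and> openin Y (f ` U) \<and>
       homeomorphic_map (subtopology X U) (subtopology Y (f ` U)) f)"

locale etale_groupoid = lch_groupoid +
  assumes local_homeo_r: "local_homeomorphism X (subtopology X G0) r"
    and local_homeo_s: "local_homeomorphism X (subtopology X G0) s"

definition open_bisection ::
    "'g topology \<Rightarrow> 'g set \<Rightarrow> ('g \<Rightarrow> 'g) \<Rightarrow> ('g \<Rightarrow> 'g) \<Rightarrow> 'g set \<Rightarrow> bool" where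
  "open_bisection X G0 r s U \<longleftrightarrow> openin X U \<and>
     openin (subtopology X G0) (r ` U) \<and>
     homeomorphic_map (subtopology X U) (subtopology (subtopology X G0) (r ` U)) r \<and>
     openin (subtopology X G0) (s ` U) \<and>
     homeomorphic_map (subtopology X U) (subtopology (subtopology X G0) (s ` U)) s"

section \<open>Smooth functions on open subsets of Euclidean space\<close>

text \<open>The \<open>n\<close>-dimensional real space is \<^const>\<open>Euclidean_space\<close> \<open>n\<close>, the space of real sequences that
  vanish from index \<open>n\<close> on, so that dimension 0 is included. The definitions below are meant for sets
  \<open>U\<close> open in that space; they depend only on the values of the function on \<open>U\<close>.\<close>

definition partial_deriv :: "nat \<Rightarrow> ((nat \<Rightarrow> real) \<Rightarrow> real) \<Rightarrow> (nat \<Rightarrow> real) \<Rightarrow> real" where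
  "partial_deriv i f x = deriv (\<lambda>t. f (x(i := t))) (x i)"

fun Ck_on :: "nat \<Rightarrow> nat \<Rightarrow> (nat \<Rightarrow> real) set \<Rightarrow> ((nat \<Rightarrow> real) \<Rightarrow> real) \<Rightarrow> bool" where
  "Ck_on n 0 U f \<longleftrightarrow> continuous_map (subtopology (Euclidean_space n) U) euclideanreal f"
| "Ck_on n (Suc k) U f \<longleftrightarrow>
     continuous_map (subtopology (Euclidean_space n) U) euclideanreal f \<and>
     (\<forall>i<n. (\<forall>x\<in>U. (\<lambda>t. f (x(i := t))) differentiable at (x i)) \<and>
            Ck_on n k U (partial_deriv i f))"

definition smooth_on ::
    "nat \<Rightarrow> (nat \<Rightarrow> real) set \<Rightarrow> ((nat \<Rightarrow> real) \<Rightarrow> (nat \<Rightarrow> real)) \<Rightarrow> bool" where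
  "smooth_on n U F \<longleftrightarrow> (\<forall>j<n. \<forall>k. Ck_on n k U (\<lambda>x. F x j))"

section \<open>Smooth structures\<close>

text \<open>A chart is a pair of a domain \<open>U\<close> and a total function, of which only the values on \<open>U\<close>
  matter.\<close>

type_synonym 'a chart = "'a set \<times> ('a \<Rightarrow> nat \<Rightarrow> real)"

definition is_chart :: "'a topology \<Rightarrow> nat \<Rightarrow> 'a chart \<Rightarrow> bool" where
  "is_chart X n = (\<lambda>(U, \<phi>). openin X U \<and> openin (Euclidean_space n) (\<phi> ` U) \<and>
     homeomorphic_map (subtopology X U) (subtopology (Euclidean_space n) (\<phi> ` U)) \<phi>)"

definition smooth_transition :: "nat \<Rightarrow> 'a chart \<Rightarrow> 'a chart \<Rightarrow> bool" where
  "smooth_transition n = (\<lambda>(U, \<phi>) (V, \<theta>). smooth_on n (\<phi> ` (U \<inter> V)) (\<theta> \<circ> inv_into U \<phi>))"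

definition smooth_atlas :: "'a topology \<Rightarrow> nat \<Rightarrow> 'a chart set \<Rightarrow> bool" where
  "smooth_atlas X n A \<longleftrightarrow>
     (\<forall>c\<in>A. is_chart X n c) \<and> \<Union> (fst ` A) = topspace X \<and>
     (\<forall>c\<in>A. \<forall>d\<in>A. smooth_transition n c d)"

definition compatible_atlases :: "'a topology \<Rightarrow> nat \<Rightarrow> 'a chart set \<Rightarrow> 'a chart set \<Rightarrow> bool" where
  "compatible_atlases X n A B \<longleftrightarrow> smooth_atlas X n (A \<union> B)"

definition smooth_structure :: "'a topology \<Rightarrow> nat \<Rightarrow> 'a chart set \<Rightarrow> bool" where
  "smooth_structure X n S \<longleftrightarrow>
     smooth_atlas X n S \<and> (\<forall>A. smooth_atlas X n A \<and> S \<subseteq> A \<longrightarrow> A = S)"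

definition atlas_for :: "'a topology \<Rightarrow> nat \<Rightarrow> 'a chart set \<Rightarrow> 'a chart set \<Rightarrow> bool" where
  "atlas_for X n S A \<longleftrightarrow> smooth_structure X n S \<and> smooth_atlas X n A \<and> A \<subseteq> S"

definition smooth_manifold :: "'a topology \<Rightarrow> nat \<Rightarrow> 'a chart set \<Rightarrow> bool" where
  "smooth_manifold X n S \<longleftrightarrow>
     Hausdorff_space X \<and> second_countable X \<and> smooth_structure X n S"

section \<open>Local diffeomorphisms\<close>

definition smooth_map ::
    "nat \<Rightarrow> 'a topology \<Rightarrow> 'a chart set \<Rightarrow> 'b topology \<Rightarrow> 'b chart set \<Rightarrow> ('a \<Rightarrow> 'b) \<Rightarrow> bool" where
  "smooth_map n X A Y B f \<longleftrightarrow> continuous_map X Y f \<and>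
     (\<forall>(U, \<phi>)\<in>A. \<forall>(V, \<theta>)\<in>B. smooth_on n (\<phi> ` (U \<inter> f -` V)) (\<theta> \<circ> f \<circ> inv_into U \<phi>))"

definition diffeomorphism ::
    "nat \<Rightarrow> 'a topology \<Rightarrow> 'a chart set \<Rightarrow> 'b topology \<Rightarrow> 'b chart set \<Rightarrow> ('a \<Rightarrow> 'b) \<Rightarrow> bool" where
  "diffeomorphism n X A Y B f \<longleftrightarrow> bij_betw f (topspace X) (topspace Y) \<and>
     smooth_map n X A Y B f \<and> smooth_map n Y B X A (inv_into (topspace X) f)"

definition restrict_charts :: "'a set \<Rightarrow> 'a chart set \<Rightarrow> 'a chart set" where
  "restrict_charts N A = (\<lambda>(U, \<phi>). (U \<inter> N, \<phi>)) ` A"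

definition local_diffeomorphism ::
    "nat \<Rightarrow> 'a topology \<Rightarrow> 'a chart set \<Rightarrow> 'b topology \<Rightarrow> 'b chart set \<Rightarrow> ('a \<Rightarrow> 'b) \<Rightarrow> bool" where
  "local_diffeomorphism n X A Y B f \<longleftrightarrow>
     (\<forall>x\<in>topspace X. \<exists>N. openin X N \<and> x \<in> N \<and> openin Y (f ` N) \<and>
        diffeomorphism n (subtopology X N) (restrict_charts N A)
          (subtopology Y (f ` N)) (restrict_charts (f ` N) B) f)"

section \<open>The charts lifted along the range map\<close>

definition lift_index ::
    "'g topology \<Rightarrow> 'g set \<Rightarrow> ('g \<Rightarrow> 'g) \<Rightarrow> ('g \<Rightarrow> 'g) \<Rightarrow> 'i set \<Rightarrow> ('i \<Rightarrow> 'g set) \<Rightarrow> ('g set \<times> 'i) set" where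
  "lift_index X G0 r s I W = {(B, \<alpha>). open_bisection X G0 r s B \<and> \<alpha> \<in> I \<and> r ` B \<subseteq> W \<alpha>}"

definition lift_chart ::
    "('g \<Rightarrow> 'g) \<Rightarrow> ('i \<Rightarrow> 'g \<Rightarrow> nat \<Rightarrow> real) \<Rightarrow> 'g set \<times> 'i \<Rightarrow> 'g chart" where
  "lift_chart r \<psi> = (\<lambda>(B, \<alpha>). (B, \<lambda>\<gamma>. \<psi> \<alpha> (r \<gamma>)))"

definition lifted_atlas ::
    "'g topology \<Rightarrow> 'g set \<Rightarrow> ('g \<Rightarrow> 'g) \<Rightarrow> ('g \<Rightarrow> 'g) \<Rightarrow> 'i set \<Rightarrow> ('i \<Rightarrow> 'g set) \<Rightarrow>
      ('i \<Rightarrow> 'g \<Rightarrow> nat \<Rightarrow> real) \<Rightarrow> 'g chart set" where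
  "lifted_atlas X G0 r s I W \<psi> = lift_chart r \<psi> ` lift_index X G0 r s I W"

end

theory Submission
  imports Defs
begin

text \<open>
  The substance of the theorem is smoothness of transition maps, and smoothness on a subset
  of \<open>n\<close>-space is a local property that depends only on values near each point
  (\<open>smooth_on_locally\<close>). In a transition between two lifted charts the range map cancels:
  if \<open>x = \<psi>\<^sub>\<alpha> (r \<gamma>)\<close>, then both the lifted transition and the transition from
  \<open>\<psi>\<^sub>\<alpha>\<close> to \<open>\<psi>\<^sub>\<beta>\<close> on the unit space send \<open>x\<close> to \<open>\<psi>\<^sub>\<beta> (r \<gamma>)\<close>. So the lifted
  transitions are restrictions of transitions of the given atlas (\<open>smooth_transition_pullback\<close>).
  Lifted charts cover the arrows because the open bisections form a base for the topology of an etale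
  groupoid (\<open>open_bisection_within\<close>). The resulting atlas lies in a maximal one by Zorn's lemma
  (\<open>smooth_structure_extending\<close>), since charts of an atlas are compared only in pairs.

  For the compatibility statement, let \<open>r\<close> be a local diffeomorphism from another smooth structure.
  The transition from a chart \<open>\<phi>\<close> of that structure to a lifted chart is
  \<open>\<psi>\<^sub>\<alpha> \<circ> r \<circ> \<phi>\<^sup>-\<^sup>1\<close>, which is the coordinate expression of \<open>r\<close>;
  in the opposite direction it is, near each point, the coordinate expression of a local inverse of
  \<open>r\<close>. Hence the smoothness of both is what a local diffeomorphism provides
  (\<open>smooth_transition_to_pullback\<close>, \<open>smooth_transition_from_pullback\<close>).
\<close>

section \<open>Smoothness is a local property\<close>

lemma eventually_line_in_open:
  assumes U: "openin (Euclidean_space n) U" and x: "x \<in> U" and i: "i < n"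
  shows "eventually (\<lambda>t. x(i := t) \<in> U) (nhds (x i))"
proof -
  have xE: "x \<in> topspace (Euclidean_space n)"
    using openin_subset[OF U] x by blast
  have "continuous_map euclideanreal (Euclidean_space n) (\<lambda>t. x(i := t))"
    unfolding Euclidean_space_def continuous_map_in_subtopology
  proof (intro conjI)
    show "continuous_map euclideanreal (powertop_real UNIV) (\<lambda>t. x(i := t))"
      by (simp add: continuous_map_componentwise_UNIV fun_upd_def)
    show "(\<lambda>t. x(i := t)) \<in> topspace euclideanreal \<rightarrow> {x. \<forall>i\<ge>n. x i = 0}"
      using xE i by (auto simp: topspace_Euclidean_space)
  qed
  then have "openin euclideanreal {t \<in> topspace euclideanreal. x(i := t) \<in> U}"
    using U openin_continuous_map_preimage by blast
  then have "open {t. x(i := t) \<in> U}"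
    by simp
  moreover have "x i \<in> {t. x(i := t) \<in> U}"
    using x by simp
  ultimately show ?thesis
    by (metis (mono_tags, lifting) eventually_nhds mem_Collect_eq)
qed

lemma Ck_on_subset: "Ck_on n k U f \<Longrightarrow> V \<subseteq> U \<Longrightarrow> Ck_on n k V f"
  by (induction k arbitrary: f) (auto intro: continuous_map_from_subtopology_mono)

lemma continuous_map_locally_eq:
  assumes "\<And>x. x \<in> U \<Longrightarrow>
    \<exists>V g. openin X V \<and> x \<in> V \<and> (\<forall>y\<in>V. f y = g y) \<and> continuous_map (subtopology X V) Y g"
  shows "continuous_map (subtopology X U) Y f"
proof -
  obtain V where V: "\<And>x. x \<in> U \<Longrightarrow>
      openin X (V x) \<and> x \<in> V x \<and> continuous_map (subtopology X (V x)) Y f"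
  proof -
    have "\<exists>V. openin X V \<and> x \<in> V \<and> continuous_map (subtopology X V) Y f" if x: "x \<in> U" for x
    proof -
      obtain V g where "openin X V" "x \<in> V" "\<forall>y\<in>V. f y = g y"
        "continuous_map (subtopology X V) Y g"
        using assms[OF x] by blast
      then have "continuous_map (subtopology X V) Y f"
        by (auto intro: continuous_map_eq)
      then show ?thesis
        using \<open>openin X V\<close> \<open>x \<in> V\<close> by blast
    qed
    then show ?thesis
      using that by metis
  qed
  show ?thesis
  proof (rule pasting_lemma[where I = U and T = "\<lambda>x. U \<inter> V x" and f = "\<lambda>_. f"])
    fix x assume "x \<in> U"
    then show "openin (subtopology X U) (U \<inter> V x)"
      using V openin_subtopology_Int2 by blast
    have "continuous_map (subtopology X (U \<inter> V x)) Y f"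
      using V[OF \<open>x \<in> U\<close>] by (auto intro: continuous_map_from_subtopology_mono)
    then show "continuous_map (subtopology (subtopology X U) (U \<inter> V x)) Y f"
      by (simp add: subtopology_subtopology)
  next
    fix x assume "x \<in> topspace (subtopology X U)"
    then show "\<exists>j. j \<in> U \<and> x \<in> U \<inter> V j \<and> f x = f x"
      using V by (intro exI[of _ x]) auto
  qed auto
qed

text \<open>Two functions that agree on an open set have the same partial derivatives there, because a
  coordinate line through a point of an open set stays in the set for a while. This lets the
  induction pass from \<open>f\<close> and \<open>g\<close> to their partial derivatives.\<close>

lemma Ck_on_locally:
  assumes "\<And>x. x \<in> U \<Longrightarrow>
    \<exists>V g. openin (Euclidean_space n) V \<and> x \<in> V \<and> (\<forall>y\<in>V. f y = g y) \<and> Ck_on n k V g"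
  shows "Ck_on n k U f"
  using assms
proof (induction k arbitrary: f)
  case 0
  then show ?case
    unfolding Ck_on.simps by (rule continuous_map_locally_eq)
next
  case (Suc k)
  have ev: "eventually (\<lambda>t. f (y(i := t)) = g (y(i := t))) (nhds (y i))"
    if "openin (Euclidean_space n) V" "\<forall>y\<in>V. f y = g y" "y \<in> V" "i < n" for V g y i
    by (rule eventually_mono[OF eventually_line_in_open[OF that(1,3,4)]]) (use that(2) in simp)
  have "continuous_map (subtopology (Euclidean_space n) U) euclideanreal f"
  proof (rule continuous_map_locally_eq)
    fix x assume "x \<in> U"
    then show "\<exists>V g. openin (Euclidean_space n) V \<and> x \<in> V \<and> (\<forall>y\<in>V. f y = g y) \<and>
        continuous_map (subtopology (Euclidean_space n) V) euclideanreal g"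
      using Suc.prems[of x] unfolding Ck_on.simps by blast
  qed
  moreover have "(\<lambda>t. f (x(i := t))) differentiable at (x i)" if x: "x \<in> U" and i: "i < n" for x i
  proof -
    obtain V g where V: "openin (Euclidean_space n) V" "x \<in> V" "\<forall>y\<in>V. f y = g y"
      and g: "Ck_on n (Suc k) V g"
      using Suc.prems[OF x] by blast
    have "(\<lambda>t. g (x(i := t))) differentiable at (x i)"
      using g V(2) i unfolding Ck_on.simps by blast
    then obtain D where D: "((\<lambda>t. g (x(i := t))) has_real_derivative D) (at (x i))"
      by (auto simp: real_differentiable_def)
    have "((\<lambda>t. f (x(i := t))) has_real_derivative D) (at (x i))"
      using D by (simp only: DERIV_cong_ev[OF refl ev[OF V(1,3,2) i] refl])
    then show ?thesis
      by (auto simp: real_differentiable_def)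
  qed
  moreover have "Ck_on n k U (partial_deriv i f)" if i: "i < n" for i
  proof (rule Suc.IH)
    fix x assume x: "x \<in> U"
    obtain V g where V: "openin (Euclidean_space n) V" "x \<in> V" "\<forall>y\<in>V. f y = g y"
      and g: "Ck_on n (Suc k) V g"
      using Suc.prems[OF x] by blast
    have "\<forall>y\<in>V. partial_deriv i f y = partial_deriv i g y"
      unfolding partial_deriv_def using deriv_cong_ev[OF ev[OF V(1,3) _ i] refl] by blast
    moreover have "Ck_on n k V (partial_deriv i g)"
      using g i unfolding Ck_on.simps by blast
    ultimately show "\<exists>V g. openin (Euclidean_space n) V \<and> x \<in> V \<and>
        (\<forall>y\<in>V. partial_deriv i f y = g y) \<and> Ck_on n k V g"
      using V(1,2) by blast
  qed
  ultimately show ?case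
    unfolding Ck_on.simps by blast
qed

text \<open>The set \<open>D\<close> is separate from the neighbourhood \<open>V\<close> so that \<open>D\<close> can be the domain that comes
  with a known smooth map, while openness is required of a small neighbourhood only.\<close>

lemma smooth_on_locally:
  assumes "\<And>x. x \<in> U \<Longrightarrow> \<exists>V D G. openin (Euclidean_space n) V \<and> x \<in> V \<and> V \<subseteq> D \<and>
    (\<forall>y\<in>V. F y = G y) \<and> smooth_on n D G"
  shows "smooth_on n U F"
  unfolding smooth_on_def
proof (intro allI impI)
  fix j k assume j: "j < n"
  show "Ck_on n k U (\<lambda>x. F x j)"
  proof (rule Ck_on_locally)
    fix x assume x: "x \<in> U"
    obtain V D G where V: "openin (Euclidean_space n) V" "x \<in> V" "V \<subseteq> D" "\<forall>y\<in>V. F y = G y"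
      and G: "smooth_on n D G"
      using assms[OF x] by blast
    have "Ck_on n k D (\<lambda>x. G x j)"
      using G j by (simp add: smooth_on_def)
    then have "Ck_on n k V (\<lambda>x. G x j)"
      using V(3) by (rule Ck_on_subset)
    moreover have "\<forall>y\<in>V. F y j = G y j"
      using V(4) by simp
    ultimately show "\<exists>V g. openin (Euclidean_space n) V \<and> x \<in> V \<and> (\<forall>y\<in>V. F y j = g y) \<and> Ck_on n k V g"
      using V(1,2) by (intro exI[of _ V] exI[of _ "\<lambda>x. G x j"] conjI)
  qed
qed

section \<open>Charts and maximal atlases\<close>

lemma homeomorphic_map_restrict_open:
  assumes f: "homeomorphic_map (subtopology X U) (subtopology Y (f ` U)) f"
    and U: "openin X U" "openin Y (f ` U)" and V: "openin X V" "V \<subseteq> U"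
  shows "openin Y (f ` V)" "homeomorphic_map (subtopology X V) (subtopology Y (f ` V)) f"
proof -
  have "openin (subtopology X U) V"
    using openin_subtopology_Int2[OF V(1), of U] V(2) by (simp add: inf.absorb2)
  then have "openin (subtopology Y (f ` U)) (f ` V)"
    using homeomorphic_imp_open_map[OF f] unfolding open_map_def by blast
  then show "openin Y (f ` V)"
    using U(2) by (rule openin_trans_full)
  have "f ` (topspace (subtopology X U) \<inter> V) = topspace (subtopology Y (f ` U)) \<inter> f ` V"
    using openin_subset[OF U(1)] openin_subset[OF U(2)] V(2) by auto
  from homeomorphic_map_subtopologies[OF f this]
  show "homeomorphic_map (subtopology X V) (subtopology Y (f ` V)) f"
    using V(2) image_mono[OF V(2), of f] by (simp add: subtopology_subtopology inf.absorb2)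
qed

lemma is_chart_inj_on:
  assumes "is_chart X n (U, \<phi>)"
  shows "inj_on \<phi> U"
proof -
  have "openin X U" "homeomorphic_map (subtopology X U) (subtopology (Euclidean_space n) (\<phi> ` U)) \<phi>"
    using assms by (simp_all add: is_chart_def)
  then show ?thesis
    using homeomorphic_imp_injective_map topspace_subtopology_subset[OF openin_subset] by metis
qed

lemma is_chart_openin_image:
  assumes "is_chart X n (U, \<phi>)" "openin X V" "V \<subseteq> U"
  shows "openin (Euclidean_space n) (\<phi> ` V)"
  using assms homeomorphic_map_restrict_open(1)[of X U "Euclidean_space n" \<phi> V]
  by (simp add: is_chart_def)

lemma smooth_atlasD:
  assumes "smooth_atlas X n A"
  shows "c \<in> A \<Longrightarrow> is_chart X n c" "\<Union>(fst ` A) = topspace X"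
    "c \<in> A \<Longrightarrow> d \<in> A \<Longrightarrow> smooth_transition n c d"
  using assms by (simp_all add: smooth_atlas_def)

text \<open>Smoothness of transitions concerns only two charts at a time, and two charts of the union of a
  chain of atlases already lie in one member.\<close>

lemma smooth_atlas_Union_chain:
  assumes "\<C> \<noteq> {}" "subset.chain \<A> \<C>" "\<And>A. A \<in> \<C> \<Longrightarrow> smooth_atlas X n A"
  shows "smooth_atlas X n (\<Union>\<C>)"
  unfolding smooth_atlas_def
proof (intro conjI ballI)
  fix c assume "c \<in> \<Union>\<C>"
  then show "is_chart X n c"
    using smooth_atlasD(1)[OF assms(3)] by blast
next
  have "\<Union>(fst ` \<Union>\<C>) = (\<Union>A\<in>\<C>. \<Union>(fst ` A))"
    by blast
  also have "\<dots> = (\<Union>A\<in>\<C>. topspace X)"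
    using smooth_atlasD(2)[OF assms(3)] by (rule SUP_cong[OF refl])
  finally show "\<Union>(fst ` \<Union>\<C>) = topspace X"
    using assms(1) by simp
next
  fix c d assume "c \<in> \<Union>\<C>" "d \<in> \<Union>\<C>"
  then obtain A B where AB: "A \<in> \<C>" "B \<in> \<C>" "c \<in> A" "d \<in> B"
    by (elim UnionE)
  have "A \<subseteq> B \<or> B \<subseteq> A"
    using assms(2) AB(1,2) by (metis subset_chain_def)
  then consider "c \<in> B" | "d \<in> A"
    using AB(3,4) by blast
  then show "smooth_transition n c d"
    using AB smooth_atlasD(3)[OF assms(3)] by cases blast+
qed

lemma smooth_structure_extending:
  assumes A: "smooth_atlas X n A"
  obtains S where "smooth_structure X n S" "A \<subseteq> S"
proof -
  let ?\<A> = "{B. smooth_atlas X n B \<and> A \<subseteq> B}"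
  have "\<exists>S\<in>?\<A>. \<forall>B\<in>?\<A>. S \<subseteq> B \<longrightarrow> B = S"
  proof (rule subset_Zorn_nonempty)
    show "?\<A> \<noteq> {}"
      using A by blast
  next
    fix \<C> assume ne: "\<C> \<noteq> {}" and ch: "subset.chain ?\<A> \<C>"
    then have sub: "\<C> \<subseteq> ?\<A>"
      by (simp add: subset_chain_def)
    have "smooth_atlas X n (\<Union>\<C>)"
      using ne ch by (rule smooth_atlas_Union_chain) (use sub in blast)
    moreover have "A \<subseteq> \<Union>\<C>"
      using ne sub by blast
    ultimately show "\<Union>\<C> \<in> ?\<A>"
      by simp
  qed
  then obtain S where S: "S \<in> ?\<A>" and max: "\<forall>B\<in>?\<A>. S \<subseteq> B \<longrightarrow> B = S"
    by (elim bexE)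
  have "B = S" if "smooth_atlas X n B" "S \<subseteq> B" for B
  proof -
    have "B \<in> ?\<A>"
      using S that by auto
    from bspec[OF max this] that(2) show ?thesis
      by (rule mp)
  qed
  then have "smooth_structure X n S"
    using S by (simp add: smooth_structure_def)
  then show ?thesis
    using S by (intro that[of S]) simp_all
qed

section \<open>Pulling back charts along a map\<close>

lemma is_chart_pullback:
  assumes B: "openin X B" "openin Y (f ` B)"
    and f: "homeomorphic_map (subtopology X B) (subtopology Y (f ` B)) f"
    and c: "is_chart Y n (W, \<psi>)" and sub: "f ` B \<subseteq> W"
  shows "is_chart X n (B, \<lambda>x. \<psi> (f x))"
proof -
  have W: "openin Y W"
    and h: "homeomorphic_map (subtopology Y W) (subtopology (Euclidean_space n) (\<psi> ` W)) \<psi>"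
    and Wim: "openin (Euclidean_space n) (\<psi> ` W)"
    using c by (auto simp: is_chart_def)
  have eq: "\<psi> ` f ` B = (\<lambda>x. \<psi> (f x)) ` B"
    by auto
  have im: "openin (Euclidean_space n) (\<psi> ` f ` B)"
    using is_chart_openin_image[OF c B(2) sub] .
  have "homeomorphic_map (subtopology Y (f ` B)) (subtopology (Euclidean_space n) (\<psi> ` f ` B)) \<psi>"
    using homeomorphic_map_restrict_open(2)[OF h W Wim B(2) sub] .
  with f have "homeomorphic_map (subtopology X B) (subtopology (Euclidean_space n) (\<psi> ` f ` B)) (\<psi> \<circ> f)"
    by (rule homeomorphic_map_compose)
  then show ?thesis
    using B(1) im by (simp add: is_chart_def eq comp_def)
qed

text \<open>With \<open>y = \<psi> (f z)\<close>, inverting the pulled-back chart gives \<open>z\<close> and inverting \<open>\<psi>\<close> gives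
  \<open>f z\<close>, so the transition between the pulled-back charts is a restriction of the original one.\<close>

lemma smooth_transition_pullback:
  assumes c: "is_chart X n (B, \<lambda>x. \<psi> (f x))" and d: "openin X B'"
    and \<psi>: "inj_on \<psi> W" and sub: "f ` B \<subseteq> W" "f ` B' \<subseteq> W'"
    and tr: "smooth_transition n (W, \<psi>) (W', \<psi>')"
  shows "smooth_transition n (B, \<lambda>x. \<psi> (f x)) (B', \<lambda>x. \<psi>' (f x))"
  unfolding smooth_transition_def prod.case
proof (rule smooth_on_locally)
  let ?V = "(\<lambda>x. \<psi> (f x)) ` (B \<inter> B')"
  fix x assume x: "x \<in> ?V"
  have B: "openin X B"
    using c by (simp add: is_chart_def)
  have "openin (Euclidean_space n) ?V"
    using is_chart_openin_image[OF c] B d by (simp add: openin_Int)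
  moreover have "?V \<subseteq> \<psi> ` (W \<inter> W')"
    using sub by auto
  moreover have "(\<lambda>x. \<psi>' (f x)) (inv_into B (\<lambda>x. \<psi> (f x)) y) = \<psi>' (inv_into W \<psi> y)" if "y \<in> ?V" for y
  proof -
    obtain z where z: "z \<in> B" "y = \<psi> (f z)"
      using \<open>y \<in> ?V\<close> by blast
    have "inv_into B (\<lambda>x. \<psi> (f x)) y = z"
      using inv_into_f_f[OF is_chart_inj_on[OF c] z(1)] z(2) by simp
    moreover have "inv_into W \<psi> y = f z"
      using inv_into_f_f[OF \<psi>, of "f z"] z sub(1) by auto
    ultimately show ?thesis
      by simp
  qed
  moreover have "smooth_on n (\<psi> ` (W \<inter> W')) (\<psi>' \<circ> inv_into W \<psi>)"
    using tr by (simp add: smooth_transition_def)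
  ultimately show "\<exists>V D G. openin (Euclidean_space n) V \<and> x \<in> V \<and> V \<subseteq> D \<and>
      (\<forall>y\<in>V. ((\<lambda>x. \<psi>' (f x)) \<circ> inv_into B (\<lambda>x. \<psi> (f x))) y = G y) \<and> smooth_on n D G"
    using x by (intro exI[of _ ?V] exI[of _ "\<psi> ` (W \<inter> W')"] exI[of _ "\<psi>' \<circ> inv_into W \<psi>"]) auto
qed

text \<open>Near a point, this transition is the coordinate expression of \<open>f\<close>.\<close>

lemma smooth_transition_to_pullback:
  assumes ld: "local_diffeomorphism n X A Y M f"
    and c: "(U, \<phi>) \<in> A" "is_chart X n (U, \<phi>)" and d: "(W, \<psi>) \<in> M"
    and B: "openin X B" "f ` B \<subseteq> W"
  shows "smooth_transition n (U, \<phi>) (B, \<lambda>x. \<psi> (f x))"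
  unfolding smooth_transition_def prod.case
proof (rule smooth_on_locally)
  fix x assume "x \<in> \<phi> ` (U \<inter> B)"
  then obtain p where p: "p \<in> U" "p \<in> B" "x = \<phi> p"
    by blast
  have "p \<in> topspace X"
    using p(2) openin_subset[OF B(1)] by blast
  then obtain N where N: "openin X N" "p \<in> N"
    and df: "diffeomorphism n (subtopology X N) (restrict_charts N A)
      (subtopology Y (f ` N)) (restrict_charts (f ` N) M) f"
    using ld unfolding local_diffeomorphism_def by blast
  have "(U \<inter> N, \<phi>) \<in> restrict_charts N A" "(W \<inter> f ` N, \<psi>) \<in> restrict_charts (f ` N) M"
    using c(1) d by (auto simp: restrict_charts_def image_iff split: prod.splits)
  then have sm: "smooth_on n (\<phi> ` (U \<inter> N \<inter> f -` (W \<inter> f ` N))) (\<psi> \<circ> f \<circ> inv_into (U \<inter> N) \<phi>)"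
    (is "smooth_on n ?D ?G")
    using df unfolding diffeomorphism_def smooth_map_def by blast
  let ?V = "\<phi> ` (U \<inter> B \<inter> N)"
  have U: "openin X U"
    using c(2) by (simp add: is_chart_def)
  have "openin (Euclidean_space n) ?V"
    using is_chart_openin_image[OF c(2)] U B(1) N(1) by (simp add: openin_Int le_infI1)
  moreover have "?V \<subseteq> ?D"
    using B(2) by auto
  moreover have "((\<lambda>x. \<psi> (f x)) \<circ> inv_into U \<phi>) y = ?G y" if "y \<in> ?V" for y
  proof -
    obtain z where z: "z \<in> U" "z \<in> N" "y = \<phi> z"
      using \<open>y \<in> ?V\<close> by blast
    have inj: "inj_on \<phi> U"
      using is_chart_inj_on[OF c(2)] .
    then have "inj_on \<phi> (U \<inter> N)"
      by (rule inj_on_subset) simp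
    then show ?thesis
      using z inj by (simp add: inv_into_f_f)
  qed
  ultimately show "\<exists>V D G. openin (Euclidean_space n) V \<and> x \<in> V \<and> V \<subseteq> D \<and>
      (\<forall>y\<in>V. ((\<lambda>x. \<psi> (f x)) \<circ> inv_into U \<phi>) y = G y) \<and> smooth_on n D G"
    using p N(2) sm by (intro exI[of _ ?V] exI[of _ ?D] exI[of _ ?G]) auto
qed

text \<open>Near a point, this transition is the coordinate expression of a local inverse of \<open>f\<close>: the
  inverse on the domain \<open>B\<close> of the pulled-back chart and the inverse on the neighbourhood \<open>N\<close>
  agree on \<open>f ` (B \<inter> N)\<close>.\<close>

lemma smooth_transition_from_pullback:
  assumes ld: "local_diffeomorphism n X A Y M f"
    and c: "(U, \<phi>) \<in> A" "openin X U" and d: "(W, \<psi>) \<in> M" "inj_on \<psi> W"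
    and b: "is_chart X n (B, \<lambda>x. \<psi> (f x))" "f ` B \<subseteq> W"
  shows "smooth_transition n (B, \<lambda>x. \<psi> (f x)) (U, \<phi>)"
  unfolding smooth_transition_def prod.case
proof (rule smooth_on_locally)
  fix x assume "x \<in> (\<lambda>x. \<psi> (f x)) ` (B \<inter> U)"
  then obtain p where p: "p \<in> U" "p \<in> B" "x = \<psi> (f p)"
    by blast
  have "p \<in> topspace X"
    using p(1) openin_subset[OF c(2)] by blast
  then obtain N where N: "openin X N" "p \<in> N"
    and df: "diffeomorphism n (subtopology X N) (restrict_charts N A)
      (subtopology Y (f ` N)) (restrict_charts (f ` N) M) f"
    using ld unfolding local_diffeomorphism_def by blast
  have top: "topspace (subtopology X N) = N"
    using openin_subset[OF N(1)] by auto
  have injN: "inj_on f N"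
    using df unfolding diffeomorphism_def top by (simp add: bij_betw_def)
  have "(U \<inter> N, \<phi>) \<in> restrict_charts N A" "(W \<inter> f ` N, \<psi>) \<in> restrict_charts (f ` N) M"
    using c(1) d(1) by (auto simp: restrict_charts_def image_iff split: prod.splits)
  then have sm: "smooth_on n (\<psi> ` (W \<inter> f ` N \<inter> inv_into N f -` (U \<inter> N)))
      (\<phi> \<circ> inv_into N f \<circ> inv_into (W \<inter> f ` N) \<psi>)"
    (is "smooth_on n ?D ?G")
    using df unfolding diffeomorphism_def smooth_map_def top by blast
  let ?V = "(\<lambda>x. \<psi> (f x)) ` (B \<inter> U \<inter> N)"
  have B: "openin X B"
    using b(1) by (simp add: is_chart_def)
  have "openin (Euclidean_space n) ?V"
    using is_chart_openin_image[OF b(1)] B c(2) N(1) by (simp add: openin_Int le_infI1)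
  moreover have "?V \<subseteq> ?D"
  proof
    fix y assume "y \<in> ?V"
    then obtain z where z: "z \<in> B" "z \<in> U" "z \<in> N" "y = \<psi> (f z)"
      by blast
    then have "f z \<in> W \<inter> f ` N \<inter> inv_into N f -` (U \<inter> N)"
      using b(2) injN by (auto simp: inv_into_f_f)
    then show "y \<in> ?D"
      using z(4) by blast
  qed
  moreover have "(\<phi> \<circ> inv_into B (\<lambda>x. \<psi> (f x))) y = ?G y" if "y \<in> ?V" for y
  proof -
    obtain z where z: "z \<in> B" "z \<in> N" "y = \<psi> (f z)"
      using \<open>y \<in> ?V\<close> by blast
    have "inv_into B (\<lambda>x. \<psi> (f x)) y = z"
      using inv_into_f_f[OF is_chart_inj_on[OF b(1)] z(1)] z(3) by simp
    moreover have "inv_into (W \<inter> f ` N) \<psi> y = f z"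
      unfolding z(3) using z b(2) by (intro inv_into_f_f inj_on_subset[OF d(2)]) auto
    ultimately show ?thesis
      using z(2) injN by (simp add: inv_into_f_f)
  qed
  ultimately show "\<exists>V D G. openin (Euclidean_space n) V \<and> x \<in> V \<and> V \<subseteq> D \<and>
      (\<forall>y\<in>V. (\<phi> \<circ> inv_into B (\<lambda>x. \<psi> (f x))) y = G y) \<and> smooth_on n D G"
    using p N(2) sm by (intro exI[of _ ?V] exI[of _ ?D] exI[of _ ?G]) auto
qed

section \<open>Open bisections of an etale groupoid\<close>

text \<open>Intersecting a neighbourhood on which \<open>r\<close> is a homeomorphism with one on which \<open>s\<close> is a
  homeomorphism gives a bisection.\<close>

lemma open_bisection_within:
  assumes G: "etale_groupoid X G0 r s mul iv" and Z: "openin X Z" "g \<in> Z"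
  obtains B where "open_bisection X G0 r s B" "g \<in> B" "B \<subseteq> Z"
proof -
  let ?Y = "subtopology X G0"
  have g: "g \<in> topspace X"
    using Z openin_subset by blast
  obtain U where U: "openin X U" "g \<in> U" "openin ?Y (r ` U)"
      "homeomorphic_map (subtopology X U) (subtopology ?Y (r ` U)) r"
    using etale_groupoid.local_homeo_r[OF G] g unfolding local_homeomorphism_def by blast
  obtain V where V: "openin X V" "g \<in> V" "openin ?Y (s ` V)"
      "homeomorphic_map (subtopology X V) (subtopology ?Y (s ` V)) s"
    using etale_groupoid.local_homeo_s[OF G] g unfolding local_homeomorphism_def by blast
  let ?B = "U \<inter> V \<inter> Z"
  have B: "openin X ?B"
    using U(1) V(1) Z(1) by (simp add: openin_Int)
  have "open_bisection X G0 r s ?B"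
    unfolding open_bisection_def
    using B homeomorphic_map_restrict_open[OF U(4,1,3) B] homeomorphic_map_restrict_open[OF V(4,1,3) B]
    by (simp add: le_infI1)
  then show ?thesis
    using that[of ?B] U(2) V(2) Z(2) by blast
qed

section \<open>The lifted atlas\<close>

lemma lifted_atlas_cases:
  assumes "c \<in> lifted_atlas X G0 r s I W \<psi>"
  obtains B \<alpha> where "c = (B, \<lambda>x. \<psi> \<alpha> (r x))" "open_bisection X G0 r s B" "\<alpha> \<in> I" "r ` B \<subseteq> W \<alpha>"
  using assms by (auto simp: lifted_atlas_def lift_index_def lift_chart_def)

lemma is_chart_lifted:
  assumes "open_bisection X G0 r s B" "is_chart (subtopology X G0) n (W, \<psi>)" "r ` B \<subseteq> W"
  shows "is_chart X n (B, \<lambda>x. \<psi> (r x))"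
  using assms by (intro is_chart_pullback[OF _ _ _ assms(2,3)]) (simp_all add: open_bisection_def)

lemma smooth_atlas_lifted:
  assumes G: "etale_groupoid X G0 r s mul iv"
    and A: "smooth_atlas (subtopology X G0) n ((\<lambda>\<alpha>. (W \<alpha>, \<psi> \<alpha>)) ` I)"
  shows "smooth_atlas X n (lifted_atlas X G0 r s I W \<psi>)" (is "smooth_atlas X n ?L")
proof -
  interpret etale_groupoid X G0 r s mul iv by (rule G)
  have chart: "is_chart (subtopology X G0) n (W \<alpha>, \<psi> \<alpha>)" if "\<alpha> \<in> I" for \<alpha>
    using smooth_atlasD(1)[OF A] that by blast
  have tr: "smooth_transition n (W \<alpha>, \<psi> \<alpha>) (W \<beta>, \<psi> \<beta>)" if "\<alpha> \<in> I" "\<beta> \<in> I" for \<alpha> \<beta>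
    using smooth_atlasD(3)[OF A] that by blast
  have charts: "is_chart X n c" if c: "c \<in> ?L" for c
  proof -
    obtain B \<alpha> where "c = (B, \<lambda>x. \<psi> \<alpha> (r x))" "open_bisection X G0 r s B" "\<alpha> \<in> I" "r ` B \<subseteq> W \<alpha>"
      using c by (rule lifted_atlas_cases)
    then show ?thesis
      using is_chart_lifted[OF _ chart] by simp
  qed
  have "smooth_transition n c d" if c: "c \<in> ?L" and d: "d \<in> ?L" for c d
  proof -
    obtain B \<alpha> where 1: "c = (B, \<lambda>x. \<psi> \<alpha> (r x))" "\<alpha> \<in> I" "r ` B \<subseteq> W \<alpha>"
      using c by (rule lifted_atlas_cases)
    obtain B' \<beta> where 2: "d = (B', \<lambda>x. \<psi> \<beta> (r x))" "\<beta> \<in> I" "r ` B' \<subseteq> W \<beta>"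
      using d by (rule lifted_atlas_cases)
    show ?thesis
      unfolding 1(1) 2(1)
    proof (rule smooth_transition_pullback[OF _ _ _ 1(3) 2(3) tr[OF 1(2) 2(2)]])
      show "is_chart X n (B, \<lambda>x. \<psi> \<alpha> (r x))" "openin X B'"
        using charts[OF c] charts[OF d] 1(1) 2(1) by (simp_all add: is_chart_def)
      show "inj_on (\<psi> \<alpha>) (W \<alpha>)"
        using chart[OF 1(2)] by (rule is_chart_inj_on)
    qed
  qed
  moreover have "\<Union>(fst ` ?L) = topspace X"
  proof (rule subset_antisym)
    show "\<Union>(fst ` ?L) \<subseteq> topspace X"
    proof (intro UN_least)
      fix c assume "c \<in> ?L"
      then have "openin X (fst c)"
        using charts[of c] by (cases c) (simp add: is_chart_def)
      then show "fst c \<subseteq> topspace X"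
        by (rule openin_subset)
    qed
    show "topspace X \<subseteq> \<Union>(fst ` ?L)"
    proof
      fix g assume g: "g \<in> topspace X"
      have "r g \<in> topspace (subtopology X G0)"
        using continuous_map_image_subset_topspace[OF continuous_r] g by blast
      also have "\<dots> = \<Union>(fst ` (\<lambda>\<alpha>. (W \<alpha>, \<psi> \<alpha>)) ` I)"
        using smooth_atlasD(2)[OF A] by (rule sym)
      finally obtain \<alpha> where \<alpha>: "\<alpha> \<in> I" "r g \<in> W \<alpha>"
        by auto
      have W: "openin (subtopology X G0) (W \<alpha>)"
        using chart[OF \<alpha>(1)] by (simp add: is_chart_def)
      have "openin X {x \<in> topspace X. r x \<in> W \<alpha>}"
        using openin_continuous_map_preimage[OF continuous_r W] .
      then obtain B where B: "open_bisection X G0 r s B" "g \<in> B" "B \<subseteq> {x \<in> topspace X. r x \<in> W \<alpha>}"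
        by (rule open_bisection_within[OF G]) (use g \<alpha>(2) in simp)
      then have "(B, \<alpha>) \<in> lift_index X G0 r s I W"
        using \<alpha>(1) by (auto simp: lift_index_def)
      then have "lift_chart r \<psi> (B, \<alpha>) \<in> ?L"
        unfolding lifted_atlas_def by (rule imageI)
      then show "g \<in> \<Union>(fst ` ?L)"
        using B(2) by (intro UN_I[of "lift_chart r \<psi> (B, \<alpha>)"]) (simp_all add: lift_chart_def)
    qed
  qed
  ultimately show ?thesis
    using charts by (simp add: smooth_atlas_def)
qed

lemma compatible_lifted_atlas:
  assumes G: "etale_groupoid X G0 r s mul iv"
    and A: "smooth_atlas (subtopology X G0) n ((\<lambda>\<alpha>. (W \<alpha>, \<psi> \<alpha>)) ` I)"
    and M: "(\<lambda>\<alpha>. (W \<alpha>, \<psi> \<alpha>)) ` I \<subseteq> M"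
    and B: "smooth_atlas X n \<B>" and ld: "local_diffeomorphism n X \<B> (subtopology X G0) M r"
  shows "compatible_atlases X n \<B> (lifted_atlas X G0 r s I W \<psi>)" (is "compatible_atlases X n \<B> ?L")
proof -
  have L: "smooth_atlas X n ?L"
    using smooth_atlas_lifted[OF G A] .
  have mixed: "smooth_transition n c d \<and> smooth_transition n d c" if c: "c \<in> \<B>" and d: "d \<in> ?L" for c d
  proof -
    obtain U \<phi> where U: "c = (U, \<phi>)" "(U, \<phi>) \<in> \<B>" "is_chart X n (U, \<phi>)" "openin X U"
      using c smooth_atlasD(1)[OF B c] by (cases c) (auto simp: is_chart_def)
    obtain C \<alpha> where C: "d = (C, \<lambda>x. \<psi> \<alpha> (r x))" "\<alpha> \<in> I" "r ` C \<subseteq> W \<alpha>"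
      using d by (rule lifted_atlas_cases)
    have dc: "is_chart X n (C, \<lambda>x. \<psi> \<alpha> (r x))" "openin X C"
      using smooth_atlasD(1)[OF L d] C(1) by (simp_all add: is_chart_def)
    have "(W \<alpha>, \<psi> \<alpha>) \<in> M"
      using M C(2) by auto
    moreover have "inj_on (\<psi> \<alpha>) (W \<alpha>)"
      using smooth_atlasD(1)[OF A] C(2) by (intro is_chart_inj_on) blast
    ultimately show ?thesis
      unfolding U(1) C(1)
      using smooth_transition_to_pullback[OF ld U(2,3) _ dc(2) C(3)]
        smooth_transition_from_pullback[OF ld U(2,4) _ _ dc(1) C(3)] by blast
  qed
  show ?thesis
    unfolding compatible_atlases_def smooth_atlas_def
  proof (intro conjI ballI)
    show "\<Union>(fst ` (\<B> \<union> ?L)) = topspace X"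
      using smooth_atlasD(2)[OF B] smooth_atlasD(2)[OF L] by (simp add: image_Un)
  next
    fix c assume "c \<in> \<B> \<union> ?L"
    then show "is_chart X n c"
      using smooth_atlasD(1)[OF B] smooth_atlasD(1)[OF L] by blast
  next
    fix c d assume "c \<in> \<B> \<union> ?L" "d \<in> \<B> \<union> ?L"
    then show "smooth_transition n c d"
      using smooth_atlasD(3)[OF B] smooth_atlasD(3)[OF L] mixed by blast
  qed
qed

theorem proposition3p1:
  fixes X :: "'g topology" and G0 :: "'g set"
    and r s :: "'g \<Rightarrow> 'g" and mul :: "'g \<Rightarrow> 'g \<Rightarrow> 'g" and iv :: "'g \<Rightarrow> 'g"
    and n :: nat and M :: "'g chart set"
    and I :: "'i set" and W :: "'i \<Rightarrow> 'g set" and \<psi> :: "'i \<Rightarrow> 'g \<Rightarrow> nat \<Rightarrow> real"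
  assumes "etale_groupoid X G0 r s mul iv"
    and "smooth_manifold (subtopology X G0) n M"
    and "atlas_for (subtopology X G0) n M ((\<lambda>\<alpha>. (W \<alpha>, \<psi> \<alpha>)) ` I)"
  shows "(\<exists>S. atlas_for X n S (lifted_atlas X G0 r s I W \<psi>)) \<and>
    (\<forall>B. smooth_structure X n B \<and> local_diffeomorphism n X B (subtopology X G0) M r
       \<longrightarrow> compatible_atlases X n B (lifted_atlas X G0 r s I W \<psi>))"
proof (intro conjI allI impI)
  have A: "smooth_atlas (subtopology X G0) n ((\<lambda>\<alpha>. (W \<alpha>, \<psi> \<alpha>)) ` I)"
    and M: "(\<lambda>\<alpha>. (W \<alpha>, \<psi> \<alpha>)) ` I \<subseteq> M"
    using assms(3) by (auto simp: atlas_for_def)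
  have L: "smooth_atlas X n (lifted_atlas X G0 r s I W \<psi>)"
    using smooth_atlas_lifted[OF assms(1) A] .
  obtain S where "smooth_structure X n S" "lifted_atlas X G0 r s I W \<psi> \<subseteq> S"
    using L by (rule smooth_structure_extending)
  then show "\<exists>S. atlas_for X n S (lifted_atlas X G0 r s I W \<psi>)"
    using L by (auto simp: atlas_for_def)
  fix B assume "smooth_structure X n B \<and> local_diffeomorphism n X B (subtopology X G0) M r"
  then show "compatible_atlases X n B (lifted_atlas X G0 r s I W \<psi>)"
    using compatible_lifted_atlas[OF assms(1) A M] by (simp add: smooth_structure_def)
qed

end
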